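(* Let $\alpha:I\subset\mathbb{R}\to E^3$ be a unit speed curve with arc length parameter $s$, curvature $\kappa$, torsion $\tau$, modified orthogonal frame $\{T,N,B\}$ and Darboux vector $w=\tau T+B$, and let $\phi$ be the angle between $B$ and $w$, with $\sin\phi=\frac{\tau}{\|w\|}$, $\cos\phi=\frac{\kappa}{\|w\|}$. Let $C$ be the vector field defined by $C=\frac{w}{\|w\|}$, let $s_C$ be the arc length parameter of the curve $(C)$ given by $s\mapsto C(s)$, let $T_C=\frac{dC}{ds_C}$ be its unit tangent vector, and let $D_{T_C}T_C=\frac{dT_C}{ds_C}$. Then, with $'=\frac{d}{ds}$, $$D_{T_C}T_C=-\sin\phi\, T-\frac{\cos\phi}{\kappa}B+\frac{\|w\|}{\phi'\kappa}N.$$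
   Context: $E^3$ is Euclidean 3-space with its standard inner product and vector product. For an analytic unit speed curve $\alpha$ whose curvature $\kappa$ is not identically zero, with torsion $\tau$ and Frenet frame $\{t,n,b\}$ (so $t'=\kappa n$, $n'=-\kappa t+\tau b$, $b'=-\tau n$), the modified orthogonal frame is $$T=\frac{d\alpha}{ds},\qquad N=\frac{dT}{ds},\qquad B=T\times N,$$ so that at points where $\kappa\neq 0$ one has $T=t$, $N=\kappa n$, $B=\kappa b$. It satisfies $\langle T,T\rangle=1$, $\langle N,N\rangle=\langle B,B\rangle=\kappa^2$, $\langle T,N\rangle=\langle T,B\rangle=\langle N,B\rangle=0$, and $$T'=N,\qquad N'=-\kappa^2T+\frac{\kappa'}{\kappa}N+\tau B,\qquad B'=-\tau N+\frac{\kappa'}{\kappa}B.$$ The Darboux vector $w=\tau T+B$, with $\|w\|=\sqrt{\kappa^2+\tau^2}$, is the vector satisfying $T'=w\times T$, $N'=w\times N$, $B'=w\times B$; it is introduced under the condition $\kappa=\text{const}$. *)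

theory Defs
  imports "HOL-Analysis.Analysis"
begin

definition real_analytic_on :: "(real \<Rightarrow> 'a::real_normed_vector) \<Rightarrow> real set \<Rightarrow> bool"
    (infixl \<open>(real'_analytic'_on)\<close> 50) where
  "f real_analytic_on S \<longleftrightarrow>
     (\<forall>x\<in>S. \<exists>r>0. \<exists>a. \<forall>y. \<bar>y - x\<bar> < r \<longrightarrow> (\<lambda>n. (y - x) ^ n *\<^sub>R a n) sums f y)"

definition unit_speed_on :: "real set \<Rightarrow> (real \<Rightarrow> real^3) \<Rightarrow> bool" where
  "unit_speed_on I \<alpha> \<longleftrightarrow>
     (\<forall>s\<in>I. \<alpha> differentiable at s \<and> norm (vector_derivative \<alpha> (at s)) = 1)"

text \<open>The definitions from here to the Darboux vector presuppose an open interval and a curve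
  of unit speed on it.\<close>

definition frame_T :: "(real \<Rightarrow> real^3) \<Rightarrow> real \<Rightarrow> real^3" where
  "frame_T \<alpha> s = vector_derivative \<alpha> (at s)"

definition frame_N :: "(real \<Rightarrow> real^3) \<Rightarrow> real \<Rightarrow> real^3" where
  "frame_N \<alpha> s = vector_derivative (frame_T \<alpha>) (at s)"

definition frame_B :: "(real \<Rightarrow> real^3) \<Rightarrow> real \<Rightarrow> real^3" where
  "frame_B \<alpha> s = cross3 (frame_T \<alpha> s) (frame_N \<alpha> s)"

definition curvature :: "(real \<Rightarrow> real^3) \<Rightarrow> real \<Rightarrow> real" where
  "curvature \<alpha> s = norm (vector_derivative (frame_T \<alpha>) (at s))"

definition frenet_n :: "(real \<Rightarrow> real^3) \<Rightarrow> real \<Rightarrow> real^3" where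
  "frenet_n \<alpha> s = vector_derivative (frame_T \<alpha>) (at s) /\<^sub>R curvature \<alpha> s"

definition frenet_b :: "(real \<Rightarrow> real^3) \<Rightarrow> real \<Rightarrow> real^3" where
  "frenet_b \<alpha> s = cross3 (frame_T \<alpha> s) (frenet_n \<alpha> s)"

text \<open>The torsion is the coefficient in the Frenet formula \<open>b' = -\<tau> n\<close>. It is meaningful
  only where the curvature does not vanish.\<close>

definition torsion :: "(real \<Rightarrow> real^3) \<Rightarrow> real \<Rightarrow> real" where
  "torsion \<alpha> s = - (vector_derivative (frenet_b \<alpha>) (at s) \<bullet> frenet_n \<alpha> s)"

definition darboux :: "(real \<Rightarrow> real^3) \<Rightarrow> real \<Rightarrow> real^3" where
  "darboux \<alpha> s = torsion \<alpha> s *\<^sub>R frame_T \<alpha> s + frame_B \<alpha> s"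

definition unit_darboux :: "(real \<Rightarrow> real^3) \<Rightarrow> real \<Rightarrow> real^3" where
  "unit_darboux \<alpha> s = darboux \<alpha> s /\<^sub>R norm (darboux \<alpha> s)"

definition regular_curve_on :: "real set \<Rightarrow> (real \<Rightarrow> real^3) \<Rightarrow> bool" where
  "regular_curve_on I \<gamma> \<longleftrightarrow>
     (\<forall>s\<in>I. \<gamma> differentiable at s \<and> vector_derivative \<gamma> (at s) \<noteq> 0)"

text \<open>Arc length is determined up to an additive constant (the choice of base point), hence a
  predicate.\<close>

definition arc_length_parameter :: "real set \<Rightarrow> (real \<Rightarrow> real^3) \<Rightarrow> (real \<Rightarrow> real) \<Rightarrow> bool" where
  "arc_length_parameter I \<gamma> \<sigma> \<longleftrightarrow>
     (\<forall>a\<in>I. \<forall>b\<in>I. a \<le> b \<longrightarrow>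
        \<sigma> b - \<sigma> a = integral {a..b} (\<lambda>u. norm (vector_derivative \<gamma> (at u))))"

text \<open>The derivative \<open>dX/d\<sigma>\<close> of a vector field \<open>X\<close> given as a function of \<open>s \<in> I\<close> with respect
  to another parameter \<open>\<sigma>\<close>: \<open>X\<close> is reexpressed as a function of \<open>\<sigma>\<close> and differentiated at the
  value \<open>\<sigma> s\<close>. The result is again regarded as a function of \<open>s\<close>.\<close>

definition deriv_wrt :: "real set \<Rightarrow> (real \<Rightarrow> real) \<Rightarrow> (real \<Rightarrow> real^3) \<Rightarrow> real \<Rightarrow> real^3" where
  "deriv_wrt I \<sigma> X s = vector_derivative (X \<circ> inv_into I \<sigma>) (at (\<sigma> s))"

end

theory Submission
  imports Defs
begin

unbundle cross3_syntax

text \<open>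
  As \<open>\<kappa>\<close> is constant, \<open>B' = -\<tau> N\<close>. Writing \<open>C = sin \<phi> T + (cos \<phi> / \<kappa>) B\<close>, the
  \<open>N\<close>-components cancel in \<open>C' = \<phi>' (cos \<phi> T - (sin \<phi> / \<kappa>) B)\<close>, a vector of length
  \<open>\<bar>\<phi>'\<bar>\<close>. Regularity of \<open>C\<close> means that \<open>\<phi>'\<close> has no zero, hence has a constant sign \<open>\<epsilon>\<close>, and the
  arc length of \<open>C\<close> is \<open>\<epsilon> \<phi>\<close> up to a constant. So \<open>T\<^sub>C = \<epsilon> (cos \<phi> T - (sin \<phi> / \<kappa>) B)\<close>, and
  differentiating once more and dividing by \<open>\<epsilon> \<phi>'\<close> makes the sign disappear.
\<close>

section \<open>Real analytic curves\<close>

text \<open>Termwise differentiation inside the interval of convergence. The derivative is again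
  delivered as a power series on that interval.\<close>

lemma power_series_has_real_derivative:
  fixes c :: "nat \<Rightarrow> real"
  assumes sums: "\<And>z. \<bar>z\<bar> < r \<Longrightarrow> (\<lambda>n. c n * z ^ n) sums g z" and "\<bar>z\<bar> < r"
  shows "(\<lambda>n. diffs c n * z ^ n) sums deriv g z"
    and "(g has_real_derivative deriv g z) (at z)"
proof -
  have summable: "summable (\<lambda>n. c n * z ^ n)" if "norm z < r" for z
    using sums[of z] that by (auto simp: sums_iff)
  have "((\<lambda>z. \<Sum>n. c n * z ^ n) has_real_derivative (\<Sum>n. diffs c n * z ^ n)) (at z)"
    by (rule termdiffs_strong'[where K = r]) (use summable \<open>\<bar>z\<bar> < r\<close> in auto)
  then have der: "(g has_real_derivative (\<Sum>n. diffs c n * z ^ n)) (at z)"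
    by (rule has_field_derivative_transform_within_open[of _ _ _ "ball 0 r"])
      (use sums \<open>\<bar>z\<bar> < r\<close> in \<open>auto simp: sums_iff\<close>)
  then have eq: "deriv g z = (\<Sum>n. diffs c n * z ^ n)"
    by (rule DERIV_imp_deriv)
  show "(g has_real_derivative deriv g z) (at z)"
    using der eq by simp
  have "summable (\<lambda>n. diffs c n * z ^ n)"
    by (rule termdiff_converges[where K = r]) (use summable \<open>\<bar>z\<bar> < r\<close> in auto)
  then show "(\<lambda>n. diffs c n * z ^ n) sums deriv g z"
    unfolding eq by (rule summable_sums)
qed

lemma sums_componentwise:
  fixes f :: "nat \<Rightarrow> 'a::euclidean_space"
  assumes "\<And>i. i \<in> Basis \<Longrightarrow> (\<lambda>n. f n \<bullet> i) sums (l \<bullet> i)"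
  shows "f sums l"
  unfolding sums_def
  by (subst tendsto_componentwise_iff) (use assms in \<open>auto simp: sums_def inner_sum_left\<close>)

text \<open>Reduces to real power series coordinate by coordinate. The series of the derivative is
  valid with the original radius \<open>r\<close>, which is why the derivative of an analytic curve
  is again analytic.\<close>

lemma vector_power_series_has_vector_derivative:
  fixes f :: "real \<Rightarrow> 'a::euclidean_space"
  assumes sums: "\<And>y. \<bar>y - x\<bar> < r \<Longrightarrow> (\<lambda>n. (y - x) ^ n *\<^sub>R a n) sums f y"
    and y: "\<bar>y - x\<bar> < r"
  shows "(f has_vector_derivative vector_derivative f (at y)) (at y)"
    and "(\<lambda>n. (y - x) ^ n *\<^sub>R (real (Suc n) *\<^sub>R a (Suc n))) sums vector_derivative f (at y)"
proof -
  \<comment> \<open>Each coordinate is recentred at 0, where the real lemma applies;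
    \<open>D\<close> reassembles the coordinate derivatives into a vector.\<close>
  define g where "g i z = f (x + z) \<bullet> i" for i z
  define D where "D = (\<Sum>i\<in>Basis. deriv (g i) (y - x) *\<^sub>R i)"
  have D: "D \<bullet> i = deriv (g i) (y - x)" if "i \<in> Basis" for i
    using that by (simp add: D_def)
  have g: "(\<lambda>n. (a n \<bullet> i) * z ^ n) sums g i z" if "\<bar>z\<bar> < r" for i z
    using bounded_linear.sums[OF bounded_linear_inner_left sums[of "x + z"], of i] that
    by (simp add: g_def mult.commute)
  note ps = power_series_has_real_derivative[of r, OF g y]
  have "((\<lambda>y. f y \<bullet> i) has_real_derivative D \<bullet> i) (at y)" if "i \<in> Basis" for i
  proof -
    \<comment> \<open>Writing \<open>y + - x\<close> matches the pattern of
      \<open>DERIV_shift\<close>, which moves the centre back to \<open>x\<close>.\<close>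
    have "(g i has_real_derivative D \<bullet> i) (at (y + - x))"
      using ps(2) D[OF that] by simp
    then show ?thesis
      by (subst (asm) DERIV_shift) (simp add: g_def)
  qed
  then have "(f has_vector_derivative D) (at y)"
    unfolding has_vector_derivative_def
    by (subst has_derivative_componentwise_within)
      (simp add: has_field_derivative_def mult_commute_abs)
  then have vd: "vector_derivative f (at y) = D" and D': "(f has_vector_derivative D) (at y)"
    by (auto simp: vector_derivative_at)
  show "(f has_vector_derivative vector_derivative f (at y)) (at y)"
    using D' vd by simp
  show "(\<lambda>n. (y - x) ^ n *\<^sub>R (real (Suc n) *\<^sub>R a (Suc n))) sums vector_derivative f (at y)"
    unfolding vd
  proof (rule sums_componentwise)
    fix i :: 'a assume "i \<in> Basis"
    then show "(\<lambda>n. ((y - x) ^ n *\<^sub>R (real (Suc n) *\<^sub>R a (Suc n))) \<bullet> i) sums (D \<bullet> i)"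
      using ps(1)[of i] by (simp add: D diffs_def mult_ac)
  qed
qed

lemma real_analytic_on_has_vector_derivative:
  fixes f :: "real \<Rightarrow> 'a::euclidean_space"
  assumes "f real_analytic_on S" and "x \<in> S"
  shows "(f has_vector_derivative vector_derivative f (at x)) (at x)"
proof -
  obtain r a where "r > 0" and "\<forall>y. \<bar>y - x\<bar> < r \<longrightarrow> (\<lambda>n. (y - x) ^ n *\<^sub>R a n) sums f y"
    using assms unfolding real_analytic_on_def by blast
  then show ?thesis
    by (intro vector_power_series_has_vector_derivative(1)[of x r a]) auto
qed

lemma real_analytic_on_vector_derivative:
  fixes f :: "real \<Rightarrow> 'a::euclidean_space"
  assumes "f real_analytic_on S"
  shows "(\<lambda>x. vector_derivative f (at x)) real_analytic_on S"
  unfolding real_analytic_on_def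
proof
  fix x assume "x \<in> S"
  then obtain r a where "r > 0" and r: "\<forall>y. \<bar>y - x\<bar> < r \<longrightarrow> (\<lambda>n. (y - x) ^ n *\<^sub>R a n) sums f y"
    using assms unfolding real_analytic_on_def by blast
  then show "\<exists>r>0. \<exists>a. \<forall>y. \<bar>y - x\<bar> < r \<longrightarrow>
      (\<lambda>n. (y - x) ^ n *\<^sub>R a n) sums vector_derivative f (at y)"
    using vector_power_series_has_vector_derivative(2)[of x r a f]
    by (intro exI[of _ r] conjI exI[of _ "\<lambda>n. real (Suc n) *\<^sub>R a (Suc n)"]) blast+
qed

section \<open>Reparametrization by arc length\<close>

text \<open>With a negative derivative \<open>f\<close> would drop immediately to the right of
  \<open>x\<close>, and openness keeps such points in \<open>S\<close>.\<close>

lemma strict_mono_on_imp_deriv_nonneg: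
  fixes f :: "real \<Rightarrow> real"
  assumes "strict_mono_on S f" and "open S" and "x \<in> S"
    and der: "(f has_real_derivative D) (at x)"
  shows "D \<ge> 0"
proof (rule ccontr)
  assume "\<not> D \<ge> 0"
  then obtain d where d: "d > 0" "\<And>h. 0 < h \<Longrightarrow> h < d \<Longrightarrow> f (x + h) < f x"
    using DERIV_neg_dec_right[OF der] by force
  obtain e where e: "e > 0" "ball x e \<subseteq> S"
    using assms by (meson openE)
  define h where "h = min d e / 2"
  have h: "0 < h" "h < d" "x + h \<in> ball x e"
    using d e by (auto simp: h_def dist_real_def)
  then have "f x < f (x + h)"
    using assms(1) e \<open>x \<in> S\<close> by (auto simp: strict_mono_on_def)
  with d h show False by force
qed

text \<open>By the mean value theorem two equal values would force a zero of the derivative between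
  them, at a point that the interval contains. This serves both for the sign of a derivative and for
  inverting the arc length.\<close>

lemma inj_on_if_deriv_nonzero:
  fixes f :: "real \<Rightarrow> real"
  assumes "is_interval S"
    and der: "\<And>x. x \<in> S \<Longrightarrow> (f has_real_derivative f' x) (at x)"
    and nz: "\<And>x. x \<in> S \<Longrightarrow> f' x \<noteq> 0"
  shows "inj_on f S"
proof (rule linorder_inj_onI)
  fix a b assume ab: "a < b" "a \<in> S" "b \<in> S"
  then have sub: "{a..b} \<subseteq> S"
    using assms(1) by (meson atLeastAtMost_iff mem_is_interval_1_I subsetI)
  then obtain z where z: "a < z" "z < b" "f b - f a = (b - a) * f' z"
    using MVT2[of a b f f'] ab der by (meson atLeastAtMost_iff subsetD)
  then have "f' z \<noteq> 0"
    using nz sub by (meson atLeastAtMost_iff less_imp_le subsetD)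
  with z ab show "f a \<noteq> f b"
    by auto
qed auto

text \<open>Injectivity replaces Darboux's theorem here: no continuity of the derivative is needed.\<close>

lemma deriv_constant_sign:
  fixes f :: "real \<Rightarrow> real"
  assumes S: "open S" "is_interval S"
    and der: "\<And>x. x \<in> S \<Longrightarrow> (f has_real_derivative f' x) (at x)"
    and nz: "\<And>x. x \<in> S \<Longrightarrow> f' x \<noteq> 0"
  obtains \<epsilon> :: real where "\<bar>\<epsilon>\<bar> = 1" "\<And>x. x \<in> S \<Longrightarrow> \<bar>f' x\<bar> = \<epsilon> * f' x"
proof -
  have "continuous_on S f"
    using der by (meson DERIV_continuous continuous_at_imp_continuous_on)
  then consider "strict_mono_on S f" | "strict_antimono_on S f"
    using injective_eq_monotone_map[OF S(2)] inj_on_if_deriv_nonzero[OF S(2) der nz] by blast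
  then show ?thesis
  proof cases
    case 1
    then have "\<bar>f' x\<bar> = 1 * f' x" if "x \<in> S" for x
      using strict_mono_on_imp_deriv_nonneg[OF 1 S(1) that der[OF that]] by simp
    then show ?thesis using that[of 1] by simp
  next
    case 2
    then have mono: "strict_mono_on S (\<lambda>x. - f x)"
      by (auto simp: monotone_on_def)
    have "\<bar>f' x\<bar> = - 1 * f' x" if "x \<in> S" for x
      using strict_mono_on_imp_deriv_nonneg[OF mono S(1) that DERIV_minus[OF der[OF that]]] by simp
    then show ?thesis using that[of "- 1"] by simp
  qed
qed

text \<open>Identifies arc length, up to a constant, with any antiderivative \<open>f\<close> of the
  speed. The fundamental theorem of calculus for the gauge integral derives integrability of the
  speed from \<open>f\<close> itself.\<close>

lemma arc_length_parameter_eq: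
  assumes "is_interval S" and "arc_length_parameter S \<gamma> \<sigma>"
    and der: "\<And>x. x \<in> S \<Longrightarrow> (f has_real_derivative norm (vector_derivative \<gamma> (at x))) (at x)"
    and "a \<in> S" and "b \<in> S"
  shows "\<sigma> b - \<sigma> a = f b - f a"
proof -
  have *: "\<sigma> b - \<sigma> a = f b - f a" if "a \<le> b" "a \<in> S" "b \<in> S" for a b
  proof -
    have sub: "{a..b} \<subseteq> S"
      using assms(1) that by (meson atLeastAtMost_iff mem_is_interval_1_I subsetI)
    have "(f has_vector_derivative norm (vector_derivative \<gamma> (at u))) (at u within {a..b})"
      if "u \<in> {a..b}" for u
      unfolding has_real_derivative_iff_has_vector_derivative[symmetric]
      by (rule has_field_derivative_at_within[OF der]) (use sub that in blast)
    then have "((\<lambda>u. norm (vector_derivative \<gamma> (at u))) has_integral (f b - f a)) {a..b}"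
      using \<open>a \<le> b\<close> by (intro fundamental_theorem_of_calculus)
    then show ?thesis
      using assms(2) that by (auto simp: arc_length_parameter_def integral_unique)
  qed
  \<comment> \<open>\<open>arc_length_parameter\<close> speaks of ordered end points only; for
    \<open>b < a\<close> the roles are exchanged and both sides change sign.\<close>
  show ?thesis
    using *[of a b] *[of b a] assms(4,5) by linarith
qed

text \<open>The chain rule combined with the derivative of an inverse function. Since
  \<open>\<sigma>'\<close> has no zero, \<open>\<sigma>\<close> is injective on \<open>S\<close> and
  \<open>inv_into\<close> is a genuine inverse.\<close>

lemma deriv_wrt_eq:
  assumes S: "open S" "is_interval S"
    and der: "\<And>x. x \<in> S \<Longrightarrow> (\<sigma> has_real_derivative \<sigma>' x) (at x)"
    and nz: "\<And>x. x \<in> S \<Longrightarrow> \<sigma>' x \<noteq> 0"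
    and s: "s \<in> S" and X: "(X has_vector_derivative X') (at s)"
  shows "deriv_wrt S \<sigma> X s = X' /\<^sub>R \<sigma>' s"
proof -
  have inj: "inj_on \<sigma> S"
    by (rule inj_on_if_deriv_nonzero[OF S(2) der nz])
  have cont: "continuous_on S \<sigma>"
    using der by (meson DERIV_continuous continuous_at_imp_continuous_on)
  have "(inv_into S \<sigma> has_derivative (\<lambda>y. y / \<sigma>' s)) (at (\<sigma> s))"
    by (rule has_derivative_inverse_strong[OF S(1) s cont,
          where f' = "\<lambda>y. \<sigma>' s * y"])
      (use inj s nz[OF s] der[OF s] in \<open>auto simp: has_field_derivative_def fun_eq_iff\<close>)
  then have "(inv_into S \<sigma> has_vector_derivative (inverse (\<sigma>' s))) (at (\<sigma> s))"
    by (simp add: has_vector_derivative_def divide_inverse)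
  then have "(X \<circ> inv_into S \<sigma> has_vector_derivative (inverse (\<sigma>' s) *\<^sub>R X')) (at (\<sigma> s))"
    by (rule vector_diff_chain_at) (use X inj s in simp)
  then show ?thesis
    unfolding deriv_wrt_def by (rule vector_derivative_at)
qed

section \<open>The modified orthogonal frame\<close>

lemma has_vector_derivative_cross3:
  assumes "(f has_vector_derivative f') (at x)" and "(g has_vector_derivative g') (at x)"
  shows "((\<lambda>x. f x \<times> g x) has_vector_derivative f x \<times> g' + f' \<times> g x) (at x)"
  using bounded_bilinear.has_vector_derivative[OF
      bilinear_cross[unfolded bilinear_conv_bounded_bilinear] assms] .

text \<open>Compares the Leibniz rule with the zero derivative of a constant. For
  \<open>f = g\<close> it says that a vector of constant length is orthogonal to its
  derivative.\<close>

lemma has_vector_derivative_inner_const_imp: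
  fixes f g :: "real \<Rightarrow> 'a::euclidean_space"
  assumes "(f has_vector_derivative f') (at x)" and "(g has_vector_derivative g') (at x)"
    and "open S" and "x \<in> S" and "\<And>y. y \<in> S \<Longrightarrow> f y \<bullet> g y = c"
  shows "f x \<bullet> g' + f' \<bullet> g x = 0"
proof -
  have "((\<lambda>x. f x \<bullet> g x) has_vector_derivative f x \<bullet> g' + f' \<bullet> g x) (at x)"
    by (rule bounded_bilinear.has_vector_derivative[OF bounded_bilinear_inner assms(1,2)])
  moreover have "((\<lambda>x. f x \<bullet> g x) has_vector_derivative 0) (at x)"
    by (rule has_vector_derivative_transform_within_open[OF has_vector_derivative_const, of S _ c])
      (use assms(3-5) in auto)
  ultimately show ?thesis
    by (rule vector_derivative_unique_at)
qed

text \<open>As \<open>t\<close>, \<open>n\<close>, \<open>t \<times> n\<close> are mutually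
  orthogonal, \<open>v\<close> can only point along \<open>n\<close>. Scaling by
  \<open>n \<bullet> n\<close> avoids a division; the proof evaluates b \<times> (v \<times> b) for
  b = t \<times> n in two ways.\<close>

lemma parallel_if_orthogonal_cross3:
  fixes t n v :: "real^3"
  assumes "t \<bullet> t = 1" and "t \<bullet> n = 0" and "v \<bullet> t = 0" and "v \<bullet> (t \<times> n) = 0"
  shows "(n \<bullet> n) *\<^sub>R v = (v \<bullet> n) *\<^sub>R n"
proof -
  have "(t \<times> n) \<bullet> (t \<times> n) = n \<bullet> n"
    using assms by (simp add: dot_cross)
  then have "(n \<bullet> n) *\<^sub>R v = (t \<times> n) \<times> (v \<times> (t \<times> n))"
    using assms by (simp add: Lagrange[of "t \<times> n" v] inner_commute[of "t \<times> n" v])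
  also have "\<dots> = (t \<times> n) \<times> ((v \<bullet> n) *\<^sub>R t)"
    using assms by (simp add: Lagrange[of v])
  also have "\<dots> = (v \<bullet> n) *\<^sub>R n"
    using assms by (simp add: cross_mult_right cross_skew[of "t \<times> n" t] Lagrange)
  finally show ?thesis .
qed

text \<open>For constant curvature the modified frame only differs from the Frenet frame by a
  constant factor, so the term \<open>(\<kappa>' / \<kappa>) B\<close> of \<open>B'\<close> is absent.\<close>

lemma modified_frame_derivatives:
  assumes "open I" and "\<alpha> real_analytic_on I" and "unit_speed_on I \<alpha>"
    and curvature: "\<forall>s\<in>I. curvature \<alpha> s = k" and "k \<noteq> 0" and "s \<in> I"
  shows "(frame_T \<alpha> has_vector_derivative frame_N \<alpha> s) (at s)"
    and "(frame_B \<alpha> has_vector_derivative - torsion \<alpha> s *\<^sub>R frame_N \<alpha> s) (at s)"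
    and "norm (frame_T \<alpha> s) = 1"
    and "norm (frame_B \<alpha> s) = k"
    and "frame_T \<alpha> s \<bullet> frame_B \<alpha> s = 0"
proof -
  have \<kappa>: "curvature \<alpha> s = k" if "s \<in> I" for s
    using curvature that by blast
  have T_analytic: "frame_T \<alpha> real_analytic_on I"
    using real_analytic_on_vector_derivative[OF assms(2)] by (simp add: frame_T_def[abs_def])
  have N_analytic: "frame_N \<alpha> real_analytic_on I"
    using real_analytic_on_vector_derivative[OF T_analytic] by (simp add: frame_N_def[abs_def])
  have T': "(frame_T \<alpha> has_vector_derivative frame_N \<alpha> s) (at s)" if "s \<in> I" for s
    using real_analytic_on_has_vector_derivative[OF T_analytic that] by (simp add: frame_N_def)
  define N' where "N' = vector_derivative (frame_N \<alpha>) (at s)"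
  have N': "(frame_N \<alpha> has_vector_derivative N') (at s)"
    using real_analytic_on_has_vector_derivative[OF N_analytic \<open>s \<in> I\<close>] by (simp add: N'_def)
  have TT: "frame_T \<alpha> s \<bullet> frame_T \<alpha> s = 1" if "s \<in> I" for s
    using assms(3) that by (simp add: unit_speed_on_def frame_T_def dot_square_norm)
  have NN: "frame_N \<alpha> s \<bullet> frame_N \<alpha> s = k\<^sup>2" if "s \<in> I" for s
    using \<kappa>[OF that] by (auto simp: curvature_def frame_N_def dot_square_norm)
  have TN: "frame_T \<alpha> s \<bullet> frame_N \<alpha> s = 0" if "s \<in> I" for s
    using has_vector_derivative_inner_const_imp[OF T'[OF that] T'[OF that] \<open>open I\<close> that TT]
    by (simp add: inner_commute)
  \<comment> \<open>Constancy of the curvature gives \<open>N\<close> a fixed length, so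
    \<open>N'\<close> has no component along \<open>N\<close>.\<close>
  have NN': "frame_N \<alpha> s \<bullet> N' = 0"
    using has_vector_derivative_inner_const_imp[OF N' N' \<open>open I\<close> \<open>s \<in> I\<close> NN]
    by (simp add: inner_commute)
  define B' where "B' = frame_T \<alpha> s \<times> N'"
  have B': "(frame_B \<alpha> has_vector_derivative B') (at s)"
  proof -
    have "frame_B \<alpha> = (\<lambda>s. frame_T \<alpha> s \<times> frame_N \<alpha> s)"
      by (simp add: fun_eq_iff frame_B_def)
    with has_vector_derivative_cross3[OF T'[OF \<open>s \<in> I\<close>] N'] show ?thesis
      unfolding B'_def by (simp only: cross_refl add_0_right)
  qed
  have "((\<lambda>s. frame_B \<alpha> s /\<^sub>R k) has_vector_derivative B' /\<^sub>R k) (at s)"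
    by (rule bounded_linear.has_vector_derivative[OF bounded_linear_scaleR_right B'])
  then have "(frenet_b \<alpha> has_vector_derivative B' /\<^sub>R k) (at s)"
    by (rule has_vector_derivative_transform_within_open[OF _ \<open>open I\<close> \<open>s \<in> I\<close>])
      (simp add: frame_B_def frenet_b_def frenet_n_def \<kappa> cross_mult_right frame_N_def)
  \<comment> \<open>On \<open>I\<close> the Frenet vectors n and b are N/k and B/k; their two
    factors 1/k account for the square.\<close>
  then have \<tau>: "torsion \<alpha> s * k\<^sup>2 = - (B' \<bullet> frame_N \<alpha> s)"
    using \<open>k \<noteq> 0\<close> \<kappa>[OF \<open>s \<in> I\<close>]
    by (simp add: torsion_def vector_derivative_at frenet_n_def frame_N_def field_simps
        power2_eq_square)
  \<comment> \<open>\<open>B'\<close> is orthogonal to T, being a cross product with T, and to B = T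
    \<times> N because \<open>N'\<close> is orthogonal to N. Only the direction of N remains, and
    the torsion gives its coefficient.\<close>
  have "k\<^sup>2 *\<^sub>R B' = (B' \<bullet> frame_N \<alpha> s) *\<^sub>R frame_N \<alpha> s"
    unfolding NN[OF \<open>s \<in> I\<close>, symmetric]
    using TT[OF \<open>s \<in> I\<close>] TN[OF \<open>s \<in> I\<close>] NN'
    by (intro parallel_if_orthogonal_cross3[of "frame_T \<alpha> s"])
      (auto simp: B'_def dot_cross_self dot_cross inner_commute)
  also have "\<dots> = k\<^sup>2 *\<^sub>R (- torsion \<alpha> s *\<^sub>R frame_N \<alpha> s)"
    using \<tau> by (simp add: mult.commute)
  finally have "B' = - torsion \<alpha> s *\<^sub>R frame_N \<alpha> s"
    using \<open>k \<noteq> 0\<close> by (simp only: scaleR_cancel_left zero_eq_power2) simp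
  then show "(frame_B \<alpha> has_vector_derivative - torsion \<alpha> s *\<^sub>R frame_N \<alpha> s) (at s)"
    using B' by simp
  show "(frame_T \<alpha> has_vector_derivative frame_N \<alpha> s) (at s)"
    by (rule T'[OF \<open>s \<in> I\<close>])
  show "norm (frame_T \<alpha> s) = 1"
    using TT[OF \<open>s \<in> I\<close>] by (simp add: norm_eq_1)
  have "k \<ge> 0"
    using \<kappa>[OF \<open>s \<in> I\<close>] by (auto simp: curvature_def)
  moreover have "frame_B \<alpha> s \<bullet> frame_B \<alpha> s = k\<^sup>2"
    using TT[OF \<open>s \<in> I\<close>] TN[OF \<open>s \<in> I\<close>] NN[OF \<open>s \<in> I\<close>] by (simp add: frame_B_def dot_cross)
  ultimately show "norm (frame_B \<alpha> s) = k"
    by (simp add: norm_eq_sqrt_inner)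
  show "frame_T \<alpha> s \<bullet> frame_B \<alpha> s = 0"
    by (simp add: frame_B_def dot_cross_self)
qed

section \<open>Second derivative of the unit Darboux field along its own arc length\<close>

theorem theorem5p1:
  fixes I :: "real set"
    and \<alpha> T N B w C T\<^sub>C :: "real \<Rightarrow> real^3"
    and \<kappa> \<tau> \<phi> s\<^sub>C :: "real \<Rightarrow> real"
  assumes "open I" and "is_interval I"
    and "\<alpha> real_analytic_on I" and "unit_speed_on I \<alpha>"
    and "\<kappa> = curvature \<alpha>" and "\<tau> = torsion \<alpha>"
    and "T = frame_T \<alpha>" and "N = frame_N \<alpha>" and "B = frame_B \<alpha>"
    and "w = darboux \<alpha>" and "C = unit_darboux \<alpha>"
    and "\<kappa> constant_on I" and "\<exists>s\<in>I. \<kappa> s \<noteq> 0"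
    and "\<forall>s\<in>I. \<phi> differentiable at s"
    and "\<forall>s\<in>I. sin (\<phi> s) = \<tau> s / norm (w s)"
    and "\<forall>s\<in>I. cos (\<phi> s) = \<kappa> s / norm (w s)"
    and "regular_curve_on I C"
    and "arc_length_parameter I C s\<^sub>C"
    and "T\<^sub>C = deriv_wrt I s\<^sub>C C"
  shows "\<forall>s\<in>I. deriv_wrt I s\<^sub>C T\<^sub>C s =
           - sin (\<phi> s) *\<^sub>R T s - (cos (\<phi> s) / \<kappa> s) *\<^sub>R B s
           + (norm (w s) / (deriv \<phi> s * \<kappa> s)) *\<^sub>R N s"
proof -
  obtain k where \<kappa>: "\<And>s. s \<in> I \<Longrightarrow> \<kappa> s = k" and "k \<noteq> 0"
    using assms(12,13) unfolding constant_on_def by metis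
  then have "\<forall>s\<in>I. curvature \<alpha> s = k"
    by (simp add: assms(5))
  note frame = modified_frame_derivatives[OF assms(1,3,4) this \<open>k \<noteq> 0\<close>, folded assms(6-9)]
  have w: "w s = \<tau> s *\<^sub>R T s + B s" for s
    by (simp add: assms(6,7,9,10) darboux_def)
  have norm_w: "(norm (w s))\<^sup>2 = k\<^sup>2 + (\<tau> s)\<^sup>2" if "s \<in> I" for s
    using frame(3-5)[OF that]
    by (simp add: w norm_add_Pythagorean orthogonal_def power_mult_distrib)
  have w_pos: "norm (w s) > 0" if "s \<in> I" for s
  proof -
    have "(norm (w s))\<^sup>2 > 0"
      using norm_w[OF that] \<open>k \<noteq> 0\<close> by (simp add: add_pos_nonneg)
    then show ?thesis by simp
  qed
  have sin: "sin (\<phi> s) = \<tau> s / norm (w s)" and cos: "cos (\<phi> s) = k / norm (w s)"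
    if "s \<in> I" for s
    using assms(15,16) \<kappa> that by auto
  have \<phi>': "(\<phi> has_real_derivative deriv \<phi> s) (at s)" if "s \<in> I" for s
    using assms(14) that by (auto simp: DERIV_deriv_iff_real_differentiable)
  \<comment> \<open>\<open>P\<close> will be the unit tangent of \<open>C\<close> up to sign: the
    expression of \<open>C\<close> in T and B/k, turned by a right angle in their plane.\<close>
  define P where "P s = cos (\<phi> s) *\<^sub>R T s - (sin (\<phi> s) / k) *\<^sub>R B s" for s
  have norm_P: "norm (P s) = 1" if "s \<in> I" for s
  proof -
    have "P s = cos (\<phi> s) *\<^sub>R T s + (- (sin (\<phi> s) / k)) *\<^sub>R B s"
      by (simp add: P_def)
    moreover have "orthogonal (cos (\<phi> s) *\<^sub>R T s) ((- (sin (\<phi> s) / k)) *\<^sub>R B s)"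
      using frame(5)[OF that] by (simp add: orthogonal_def)
    ultimately have "(norm (P s))\<^sup>2 =
        (norm (cos (\<phi> s) *\<^sub>R T s))\<^sup>2 + (norm ((- (sin (\<phi> s) / k)) *\<^sub>R B s))\<^sup>2"
      by (simp only: norm_add_Pythagorean)
    also have "\<dots> = 1"
      using frame(3,4)[OF that] \<open>k \<noteq> 0\<close> by (simp add: power_mult_distrib power_divide)
    finally show ?thesis
      using power2_eq_imp_eq[of "norm (P s)" 1] by simp
  qed
  have C': "(C has_vector_derivative deriv \<phi> s *\<^sub>R P s) (at s)" if "s \<in> I" for s
  proof -
    have "((\<lambda>s. sin (\<phi> s) *\<^sub>R T s + (cos (\<phi> s) / k) *\<^sub>R B s) has_vector_derivative
        (sin (\<phi> s) *\<^sub>R N s + (cos (\<phi> s) * deriv \<phi> s) *\<^sub>R T s)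
        + ((cos (\<phi> s) / k) *\<^sub>R (- \<tau> s *\<^sub>R N s) + (- sin (\<phi> s) * deriv \<phi> s / k) *\<^sub>R B s)) (at s)"
      by (intro has_vector_derivative_add has_vector_derivative_scaleR frame[OF that])
        (use \<open>k \<noteq> 0\<close> in \<open>auto intro!: derivative_eq_intros \<phi>'[OF that]\<close>)
    \<comment> \<open>This says that the tangent of the angle is \<tau>/k; it makes the two
      \<open>N\<close> terms cancel.\<close>
    moreover have "sin (\<phi> s) = cos (\<phi> s) / k * \<tau> s"
      using sin[OF that] cos[OF that] \<open>k \<noteq> 0\<close> by simp
    ultimately have "((\<lambda>s. sin (\<phi> s) *\<^sub>R T s + (cos (\<phi> s) / k) *\<^sub>R B s) has_vector_derivative
        deriv \<phi> s *\<^sub>R P s) (at s)"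
      by (simp add: P_def algebra_simps)
    then show ?thesis
    proof (rule has_vector_derivative_transform_within_open[OF _ \<open>open I\<close> that])
      fix s assume "s \<in> I"
      have "C s = (\<tau> s *\<^sub>R T s + B s) /\<^sub>R norm (w s)"
        unfolding w[symmetric] by (simp add: assms(10,11) unit_darboux_def)
      moreover have "sin (\<phi> s) = inverse (norm (w s)) * \<tau> s"
        and "cos (\<phi> s) / k = inverse (norm (w s))"
        using sin[OF \<open>s \<in> I\<close>] cos[OF \<open>s \<in> I\<close>] \<open>k \<noteq> 0\<close> by (simp_all add: divide_inverse)
      ultimately show "sin (\<phi> s) *\<^sub>R T s + (cos (\<phi> s) / k) *\<^sub>R B s = C s"
        by (simp only: scaleR_add_right scaleR_scaleR)
    qed
  qed
  have \<phi>'_nz: "deriv \<phi> s \<noteq> 0" if "s \<in> I" for s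
    using assms(17) that vector_derivative_at[OF C'[OF that]] by (auto simp: regular_curve_on_def)
  obtain \<epsilon> :: real where \<epsilon>: "\<bar>\<epsilon>\<bar> = 1" "\<And>s. s \<in> I \<Longrightarrow> \<bar>deriv \<phi> s\<bar> = \<epsilon> * deriv \<phi> s"
    using deriv_constant_sign[OF assms(1,2) \<phi>' \<phi>'_nz] by blast
  have \<epsilon>\<phi>': "((\<lambda>s. \<epsilon> * \<phi> s + c) has_real_derivative \<epsilon> * deriv \<phi> s) (at s)" if "s \<in> I" for s c
    by (auto intro!: derivative_eq_intros \<phi>'[OF that])
  have speed: "norm (vector_derivative C (at s)) = \<epsilon> * deriv \<phi> s" if "s \<in> I" for s
    using vector_derivative_at[OF C'[OF that]] norm_P[OF that] \<epsilon>(2)[OF that] by simp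
  have \<sigma>: "s\<^sub>C b - s\<^sub>C a = \<epsilon> * \<phi> b - \<epsilon> * \<phi> a" if "a \<in> I" "b \<in> I" for a b
    by (rule arc_length_parameter_eq[OF assms(2,18) _ that]) (use \<epsilon>\<phi>'[where c = 0] speed in simp)
  \<comment> \<open>Choosing the additive constant at the point \<open>s\<close> makes
    \<open>s\<^sub>C\<close> agree with an affine function of \<open>\<phi>\<close> on all of
    \<open>I\<close>.\<close>
  have \<sigma>': "(s\<^sub>C has_real_derivative \<epsilon> * deriv \<phi> s) (at s)" if "s \<in> I" for s
    by (rule has_field_derivative_transform_within_open[OF \<epsilon>\<phi>'[OF that, of "s\<^sub>C s - \<epsilon> * \<phi> s"]
          \<open>open I\<close> that])
      (use \<sigma>[OF that] in \<open>simp add: algebra_simps\<close>)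
  have \<sigma>'_nz: "\<epsilon> * deriv \<phi> s \<noteq> 0" if "s \<in> I" for s
    using \<phi>'_nz[OF that] \<epsilon>(1) by auto
  have \<epsilon>_inv: "inverse \<epsilon> = \<epsilon>"
    using \<epsilon>(1) by (auto simp: abs_if split: if_splits)
  have deriv_wrt: "deriv_wrt I s\<^sub>C X s = X' /\<^sub>R (\<epsilon> * deriv \<phi> s)"
    if "s \<in> I" "(X has_vector_derivative X') (at s)" for X X' s
    by (rule deriv_wrt_eq[OF assms(1,2) \<sigma>' \<sigma>'_nz that])
  have T\<^sub>C: "T\<^sub>C s = \<epsilon> *\<^sub>R P s" if "s \<in> I" for s
    unfolding assms(19) deriv_wrt[OF that C'[OF that]]
    using \<phi>'_nz[OF that] by (simp add: \<epsilon>_inv)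
  show ?thesis
  proof
    fix s assume s: "s \<in> I"
    \<comment> \<open>The bracket is \<open>C s\<close> written through the angle, so division by
      the derivative of \<open>\<phi>\<close> will leave \<open>- C s\<close> and the
      \<open>N\<close> term.\<close>
    define P' where "P' = (norm (w s) / k) *\<^sub>R N s
      - deriv \<phi> s *\<^sub>R (sin (\<phi> s) *\<^sub>R T s + (cos (\<phi> s) / k) *\<^sub>R B s)"
    have "(P has_vector_derivative
        (cos (\<phi> s) *\<^sub>R N s + (- sin (\<phi> s) * deriv \<phi> s) *\<^sub>R T s)
        - ((sin (\<phi> s) / k) *\<^sub>R (- \<tau> s *\<^sub>R N s) + (cos (\<phi> s) * deriv \<phi> s / k) *\<^sub>R B s)) (at s)"
      unfolding P_def[abs_def]
      by (intro has_vector_derivative_diff has_vector_derivative_scaleR frame[OF s])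
        (use \<open>k \<noteq> 0\<close> in \<open>auto intro!: derivative_eq_intros \<phi>'[OF s]\<close>)
    \<comment> \<open>Over the common denominator k times the norm of \<open>w s\<close>, the
      numerator is k squared plus \<tau> squared, which is the square of that norm.\<close>
    moreover have "norm (w s) / k = cos (\<phi> s) + sin (\<phi> s) / k * \<tau> s"
      using norm_w[OF s] w_pos[OF s] \<open>k \<noteq> 0\<close>
      by (simp add: sin[OF s] cos[OF s] field_simps power2_eq_square)
    ultimately have "(P has_vector_derivative P') (at s)"
      by (simp add: P'_def algebra_simps)
    then have "((\<lambda>s. \<epsilon> *\<^sub>R P s) has_vector_derivative \<epsilon> *\<^sub>R P') (at s)"
      by (rule bounded_linear.has_vector_derivative[OF bounded_linear_scaleR_right])
    then have "(T\<^sub>C has_vector_derivative \<epsilon> *\<^sub>R P') (at s)"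
      by (rule has_vector_derivative_transform_within_open[OF _ \<open>open I\<close> s]) (simp add: T\<^sub>C)
    from deriv_wrt[OF s this] have "deriv_wrt I s\<^sub>C T\<^sub>C s = P' /\<^sub>R deriv \<phi> s"
      using \<epsilon>(1) by auto
    moreover have "norm (w s) / (deriv \<phi> s * \<kappa> s) = inverse (deriv \<phi> s) * (norm (w s) / k)"
      using \<kappa>[OF s] by (simp add: divide_simps)
    ultimately show "deriv_wrt I s\<^sub>C T\<^sub>C s =
           - sin (\<phi> s) *\<^sub>R T s - (cos (\<phi> s) / \<kappa> s) *\<^sub>R B s
           + (norm (w s) / (deriv \<phi> s * \<kappa> s)) *\<^sub>R N s"
      using \<phi>'_nz[OF s] \<kappa>[OF s]
      by (simp add: P'_def scaleR_diff_right)
  qed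
qed

end
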